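(* Let $\pi/2\leq\alpha<\pi$ and let $f(z)=z+\sum_{n=2}^\infty a_nz^n$ be in the class $\mathcal{M}_\Sigma(\alpha)$. Then $$|a_3|\leq\frac{1}{1+\frac12\cos\alpha}.$$
   Context: $\Delta=\{z\in\mathbb{C}:|z|<1\}$. $\mathcal{A}$ is the class of functions $f$ analytic in $\Delta$ of the form $f(z)=z+\sum_{n=2}^\infty a_nz^n$. A function $f\in\mathcal{A}$ is bi-univalent in $\Delta$ if both $f$ and $f^{-1}$ are univalent (analytic and one-to-one) in $\Delta$; here $f^{-1}$ is the local inverse of $f$ near $0$ with $f^{-1}(0)=0$, understood as analytically continued to $\Delta$. $\Sigma$ is the class of bi-univalent functions in $\Delta$. For $f\in\Sigma$ write $g=f^{-1}$, so $g(w)=w-a_2w^2+(2a_2^2-a_3)w^3-(5a_2^3-5a_2a_3+a_4)w^4+\cdots$. For $\pi/2\leq\alpha<\pi$, $\mathcal{M}_\Sigma(\alpha)$ is the class of $f\in\Sigma$ such that $$1+\frac{\alpha-\pi}{2\sin\alpha}<\mathrm{Re}\left\{\frac{zf'(z)}{f(z)}\right\}<1+\frac{\alpha}{2\sin\alpha}\quad(z\in\Delta)$$ and $$1+\frac{\alpha-\pi}{2\sin\alpha}<\mathrm{Re}\left\{\frac{wg'(w)}{g(w)}\right\}<1+\frac{\alpha}{2\sin\alpha}\quad(w\in\Delta),$$ where both quotients are taken to be $1$ at the origin. *)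

theory Defs
  imports "HOL-Complex_Analysis.Complex_Analysis"
begin

abbreviation unit_disc :: "complex set" ("\<Delta>") where
  "\<Delta> \<equiv> ball 0 1"

definition normalized_expansion :: "(complex \<Rightarrow> complex) \<Rightarrow> (nat \<Rightarrow> complex) \<Rightarrow> bool" where
  "normalized_expansion f a \<longleftrightarrow>
     (\<forall>z\<in>\<Delta>. (\<lambda>n. a (n + 2) * z ^ (n + 2)) sums (f z - z))"

definition class_A :: "(complex \<Rightarrow> complex) set" where
  "class_A = {f. f holomorphic_on \<Delta> \<and> (\<exists>a. normalized_expansion f a)}"

definition univalent :: "(complex \<Rightarrow> complex) \<Rightarrow> bool" where
  "univalent f \<longleftrightarrow> f holomorphic_on \<Delta> \<and> inj_on f \<Delta>"

text \<open>
  \<open>inverse_extension f g\<close>: the function \<open>g\<close> is analytic on the whole disc and agrees near 0 with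
  the local inverse of \<open>f\<close> vanishing at 0, i.e. it is the analytic continuation of that local
  inverse to the disc.
\<close>

definition inverse_extension :: "(complex \<Rightarrow> complex) \<Rightarrow> (complex \<Rightarrow> complex) \<Rightarrow> bool" where
  "inverse_extension f g \<longleftrightarrow>
     g holomorphic_on \<Delta> \<and> g 0 = 0 \<and> (\<forall>\<^sub>F w in nhds 0. f (g w) = w)"

lemma inverse_extension_unique:
  assumes "univalent f" "inverse_extension f g" "inverse_extension f h" "w \<in> \<Delta>"
  shows "g w = h w"
proof -
  have in_disc: "\<forall>\<^sub>F w in nhds 0. k w \<in> \<Delta>" if "inverse_extension f k" for k
  proof -
    have "isCont k 0"
      using that holomorphic_on_imp_continuous_on[of k "\<Delta>"]
      by (auto simp: inverse_extension_def continuous_on_eq_continuous_at)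
    hence "filterlim k (nhds (k 0)) (nhds 0)"
      by (simp add: isCont_def tendsto_at_iff_tendsto_nhds)
    thus ?thesis
      using that by (intro topological_tendstoD[of k "k 0"]) (auto simp: inverse_extension_def)
  qed
  have "\<forall>\<^sub>F w in nhds 0. f (g w) = w" "\<forall>\<^sub>F w in nhds 0. f (h w) = w"
    using assms by (auto simp: inverse_extension_def)
  with in_disc[OF assms(2)] in_disc[OF assms(3)]
  have "\<forall>\<^sub>F w in nhds 0. g w = h w"
  proof eventually_elim
    case (elim w)
    thus ?case using assms(1) unfolding univalent_def inj_on_def by metis
  qed
  then obtain U where U: "open U" "0 \<in> U" "\<And>w. w \<in> U \<Longrightarrow> g w = h w"
    unfolding eventually_nhds by blast
  show ?thesis
  proof (rule analytic_continuation_open[of "U \<inter> \<Delta>" "\<Delta>" g h])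
    show "U \<inter> \<Delta> \<noteq> {}" using U(2) by force
  qed (use U assms in \<open>auto simp: inverse_extension_def\<close>)
qed

text \<open>
  If \<open>f\<close> is univalent, the continued inverse is unique on the disc, so whenever it exists the
  choice below is immaterial there.
\<close>

definition inverse_fun :: "(complex \<Rightarrow> complex) \<Rightarrow> complex \<Rightarrow> complex" where
  "inverse_fun f = (SOME g. inverse_extension f g)"

definition class_Sigma :: "(complex \<Rightarrow> complex) set" where
  "class_Sigma = {f \<in> class_A. univalent f \<and>
     (\<exists>g. inverse_extension f g) \<and> univalent (inverse_fun f)}"

definition starlike_quotient :: "(complex \<Rightarrow> complex) \<Rightarrow> complex \<Rightarrow> complex" where
  "starlike_quotient f z = (if z = 0 then 1 else z * deriv f z / f z)"

definition strip_condition :: "real \<Rightarrow> (complex \<Rightarrow> complex) \<Rightarrow> bool" where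
  "strip_condition \<alpha> f \<longleftrightarrow>
     (\<forall>z\<in>\<Delta>. 1 + (\<alpha> - pi) / (2 * sin \<alpha>) < Re (starlike_quotient f z) \<and>
             Re (starlike_quotient f z) < 1 + \<alpha> / (2 * sin \<alpha>))"

definition class_M_Sigma :: "real \<Rightarrow> (complex \<Rightarrow> complex) set" where
  "class_M_Sigma \<alpha> =
     {f \<in> class_Sigma. strip_condition \<alpha> f \<and> strip_condition \<alpha> (inverse_fun f)}"

end

theory Submission
  imports Defs
begin

text \<open>
  Put \<open>p(z) = z f'(z) / f(z) = 1 + q(z)\<close>. The strip condition confines \<open>q\<close> to a vertical strip,
  and \<open>w = exp (2 \<i> sin \<alpha> q)\<close> opens that strip into the sector \<open>\<alpha> - \<pi> < arg w < \<alpha>\<close>, a half-plane.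
  Its boundary line is the perpendicular bisector of \<open>1\<close> and \<open>exp (2 \<i> \<alpha>)\<close>, so the Moebius
  map \<open>w \<mapsto> (w - 1) / (exp (\<i> \<alpha>) - exp (- \<i> \<alpha>) w)\<close> carries it into the unit disc
  (\<open>exp_strip_closer_to_1\<close>). The composite \<open>u(z) = c\<^sub>1 z + c\<^sub>2 z\<^sup>2 + \<dots>\<close> is thus an analytic
  self-map of the disc, and Cauchy's inequality gives \<open>|c\<^sub>1| \<le> 1\<close> and \<open>|c\<^sub>2| \<le> 1\<close>
  (\<open>strip_function_coeff_bounds\<close>).

  Comparing coefficients in the definition of \<open>u\<close> and in \<open>f p = z f'\<close> yields
  \<open>q(z) = c\<^sub>1 z + (c\<^sub>2 - c\<^sub>1\<^sup>2 cos \<alpha>) z\<^sup>2 + \<dots>\<close> and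
  \<open>2 a\<^sub>3 = c\<^sub>2 + (1 - cos \<alpha>) c\<^sub>1\<^sup>2\<close>. For \<open>\<pi>/2 \<le> \<alpha> < \<pi>\<close> the number \<open>t = - cos \<alpha>\<close> lies in
  \<open>[0, 1)\<close>, hence \<open>|a\<^sub>3| \<le> 1 + t/2\<close>. The claimed bound is \<open>1 / (1 - t/2)\<close>, which is at least as
  large because \<open>(1 + t/2) (1 - t/2) = 1 - t\<^sup>2/4 \<le> 1\<close>.
\<close>

section \<open>Analytic functions with values in a vertical strip\<close>

text \<open>
  Cauchy's inequality on the circle of radius \<open>r < 1\<close> bounds the coefficient by \<open>B / r\<^sup>n\<close>; as \<open>u\<close>
  need not extend to the unit circle, the bound \<open>B\<close> is only reached in the limit \<open>r \<rightarrow> 1\<close>.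
\<close>

lemma bounded_on_disc_imp_norm_fps_nth_le:
  fixes u :: "complex \<Rightarrow> complex"
  assumes hol: "u holomorphic_on \<Delta>"
    and bound: "\<And>z. z \<in> \<Delta> \<Longrightarrow> norm (u z) \<le> B"
    and U: "u has_fps_expansion U"
  shows "norm (fps_nth U n) \<le> B"
proof -
  have le: "norm (fps_nth U n) * r ^ n \<le> B" if r: "0 < r" "r < 1" for r :: real
  proof -
    have sub: "cball 0 r \<subseteq> (\<Delta>)" using r by auto
    have "norm ((deriv ^^ n) u 0) \<le> fact n * B / r ^ n"
    proof (rule Cauchy_inequality)
      show "u holomorphic_on ball 0 r"
        using hol by (rule holomorphic_on_subset) (use r in auto)
      show "continuous_on (cball 0 r) u"
        using hol sub holomorphic_on_imp_continuous_on continuous_on_subset by blast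
      show "norm (u z) \<le> B" if "norm (0 - z) = r" for z
        using that r by (intro bound) auto
    qed (use r in auto)
    thus ?thesis
      using r by (simp add: fps_nth_fps_expansion[OF U] norm_divide field_simps)
  qed
  have "((\<lambda>r. norm (fps_nth U n) * r ^ n) \<longlongrightarrow> norm (fps_nth U n) * 1 ^ n) (at_left 1)"
    by (intro tendsto_intros)
  moreover have "\<forall>\<^sub>F r in at_left (1::real). norm (fps_nth U n) * r ^ n \<le> B"
    using eventually_at_left_real[of 0 "1::real"] by (rule eventually_mono) (auto intro: le)
  ultimately show ?thesis
    using tendsto_upperbound[of _ _ "at_left (1::real)" B] by simp
qed

text \<open>
  Multiplying by \<open>cis \<alpha>\<close>, the right-hand side is the distance from \<open>exp w\<close> to \<open>cis (2 \<alpha>)\<close>. The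
  points closer to \<open>1\<close> than to \<open>cis (2 \<alpha>)\<close> form the half-plane on one side of the line through
  \<open>0\<close> and \<open>cis \<alpha>\<close>, and \<open>exp w\<close> lies there since its argument \<open>Im w\<close> is between
  \<open>\<alpha> - \<pi>\<close> and \<open>\<alpha>\<close>.
\<close>

lemma exp_strip_closer_to_1:
  fixes w :: complex
  assumes \<alpha>: "0 < \<alpha>" "\<alpha> < pi" and w: "\<alpha> - pi < Im w" "Im w < \<alpha>"
  shows "norm (exp w - 1) < norm (cis \<alpha> - cis (- \<alpha>) * exp w)"
proof -
  define r t where "r = exp (Re w)" and "t = Im w"
  have e: "exp w = Complex (r * cos t) (r * sin t)"
    by (simp add: complex_eq_iff r_def t_def Re_exp Im_exp)
  have pos: "0 < r * (sin \<alpha> * sin (\<alpha> - t))"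
    using \<alpha> w by (auto simp: r_def t_def intro!: mult_pos_pos sin_gt_zero)
  have c: "cos t - cos (2 * \<alpha> - t) = 2 * (sin \<alpha> * sin (\<alpha> - t))"
    using cos_diff[of \<alpha> "\<alpha> - t"] cos_add[of \<alpha> "\<alpha> - t"]
    by (simp only: diff_diff_eq2 add_diff_eq mult_2 add_diff_cancel_left')
  have "(norm (cis \<alpha> - cis (- \<alpha>) * exp w))\<^sup>2 = 1 + r\<^sup>2 - 2 * r * cos (2 * \<alpha> - t)"
  proof -
    have "cis \<alpha> - cis (- \<alpha>) * exp w = cis (- \<alpha>) * (cis (2 * \<alpha>) - exp w)"
      by (simp add: algebra_simps cis_mult)
    hence "norm (cis \<alpha> - cis (- \<alpha>) * exp w) = norm (cis (2 * \<alpha>) - exp w)"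
      by (simp add: norm_mult)
    also have "(\<dots>)\<^sup>2 = (cos (2 * \<alpha>) - r * cos t)\<^sup>2 + (sin (2 * \<alpha>) - r * sin t)\<^sup>2"
      by (simp add: e cmod_power2)
    also have "\<dots> = ((cos (2 * \<alpha>))\<^sup>2 + (sin (2 * \<alpha>))\<^sup>2) + r\<^sup>2 * ((cos t)\<^sup>2 + (sin t)\<^sup>2)
        - 2 * r * (cos (2 * \<alpha>) * cos t + sin (2 * \<alpha>) * sin t)"
      by algebra
    also have "\<dots> = 1 + r\<^sup>2 - 2 * r * cos (2 * \<alpha> - t)"
      by (simp only: cos_diff sin_cos_squared_add sin_cos_squared_add2 mult_1_right)
    finally show ?thesis .
  qed
  moreover have "(norm (exp w - 1))\<^sup>2 = 1 + r\<^sup>2 - 2 * r * cos t"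
  proof -
    have "(norm (exp w - 1))\<^sup>2 = (r * cos t - 1)\<^sup>2 + (r * sin t)\<^sup>2"
      by (simp add: e cmod_power2)
    also have "\<dots> = r\<^sup>2 * ((cos t)\<^sup>2 + (sin t)\<^sup>2) + 1 - 2 * r * cos t"
      by algebra
    finally show ?thesis by simp
  qed
  moreover have "r * cos t - r * cos (2 * \<alpha> - t) = 2 * (r * (sin \<alpha> * sin (\<alpha> - t)))"
    using c by (metis right_diff_distrib mult.left_commute)
  ultimately have "(norm (exp w - 1))\<^sup>2 < (norm (cis \<alpha> - cis (- \<alpha>) * exp w))\<^sup>2"
    using pos by linarith
  thus ?thesis by (rule power2_less_imp_less) simp
qed

text \<open>
  The hypothesis on \<open>U\<close> is the cleared form of
  \<open>U = (E - 1) / (cis \<alpha> - cis (- \<alpha>) E)\<close>, the self-map of the disc attached to a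
  strip-valued function with expansion \<open>Q\<close>. Writing \<open>k = 2 \<i> sin \<alpha> = cis \<alpha> - cis (- \<alpha>)\<close>, each coefficient of \<open>U\<close> comes out
  of the equation with the factor \<open>k \<noteq> 0\<close>.
\<close>

lemma strip_to_disc_coeffs:
  fixes U Q :: "complex fps"
  assumes \<alpha>: "sin \<alpha> \<noteq> 0" and Q0: "fps_nth Q 0 = 0"
    and E_def: "E = fps_exp (2 * \<i> * complex_of_real (sin \<alpha>)) oo Q"
    and U: "U * (fps_const (cis \<alpha>) - fps_const (cis (- \<alpha>)) * E) = E - 1"
  shows "fps_nth U 1 = fps_nth Q 1"
    and "fps_nth U 2 = fps_nth Q 2 + complex_of_real (cos \<alpha>) * (fps_nth Q 1)\<^sup>2"
proof -
  define k where "k = 2 * \<i> * complex_of_real (sin \<alpha>)"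
  have k: "k \<noteq> 0" using \<alpha> by (simp add: k_def)
  have cis: "cis \<alpha> = cis (- \<alpha>) + k"
    by (simp add: complex_eq_iff k_def)
  have cos: "complex_of_real (cos \<alpha>) = cis (- \<alpha>) + k / 2"
    by (simp add: complex_eq_iff k_def)
  have E0: "fps_nth E 0 = 1" by (simp add: E_def)
  have E1: "fps_nth E 1 = k * fps_nth Q 1"
    by (simp add: E_def k_def fps_compose_nth)
  have E2: "fps_nth E 2 = k * fps_nth Q 2 + k\<^sup>2 / 2 * (fps_nth Q 1)\<^sup>2"
    using Q0 by (simp add: E_def k_def fps_compose_nth numeral_2_eq_2 fps_mult_nth field_simps)
  have nth: "fps_nth (U * (fps_const (cis \<alpha>) - fps_const (cis (- \<alpha>)) * E)) n = fps_nth (E - 1) n"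
    for n using U by simp
  have U0: "fps_nth U 0 = 0"
    using nth[of 0] k by (simp add: E0 cis)
  have U1: "fps_nth U 1 = fps_nth Q 1"
    using nth[of 1] k E1 by (simp add: fps_mult_nth E0 U0 cis)
  have "k * fps_nth U 2 = fps_nth E 2 + cis (- \<alpha>) * fps_nth E 1 * fps_nth U 1"
    using nth[of 2] by (simp add: fps_mult_nth numeral_2_eq_2 E0 U0 cis algebra_simps)
  also have "\<dots> = k * (fps_nth Q 2 + complex_of_real (cos \<alpha>) * (fps_nth Q 1)\<^sup>2)"
    unfolding E1 E2 U1 cos by (simp add: field_simps power2_eq_square)
  finally have "fps_nth U 2 = fps_nth Q 2 + complex_of_real (cos \<alpha>) * (fps_nth Q 1)\<^sup>2"
    using k by simp
  with U1 show "fps_nth U 1 = fps_nth Q 1"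
    "fps_nth U 2 = fps_nth Q 2 + complex_of_real (cos \<alpha>) * (fps_nth Q 1)\<^sup>2" by auto
qed

text \<open>
  The two quantities bounded here are the first two coefficients of the self-map of the disc obtained
  by composing \<open>q\<close> with the conformal map of the strip onto the disc that fixes \<open>0\<close> with derivative
  \<open>1\<close> there.
\<close>

lemma strip_function_coeff_bounds:
  fixes q :: "complex \<Rightarrow> complex"
  assumes \<alpha>: "0 < \<alpha>" "\<alpha> < pi"
    and hol: "q holomorphic_on \<Delta>" and q0: "q 0 = 0"
    and strip: "\<And>z. z \<in> \<Delta> \<Longrightarrow> (\<alpha> - pi) / (2 * sin \<alpha>) < Re (q z)"
      "\<And>z. z \<in> \<Delta> \<Longrightarrow> Re (q z) < \<alpha> / (2 * sin \<alpha>)"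
    and Q: "q has_fps_expansion Q"
  shows "norm (fps_nth Q 1) \<le> 1"
    and "norm (fps_nth Q 2 + complex_of_real (cos \<alpha>) * (fps_nth Q 1)\<^sup>2) \<le> 1"
proof -
  have s: "sin \<alpha> > 0" using \<alpha> by (rule sin_gt_zero)
  define k where "k = 2 * \<i> * complex_of_real (sin \<alpha>)"
  define e where "e = (\<lambda>z. exp (k * q z))"
  define d where "d = (\<lambda>z. cis \<alpha> - cis (- \<alpha>) * e z)"
  define u where "u = (\<lambda>z. (e z - 1) / d z)"
  have less: "norm (e z - 1) < norm (d z)" if "z \<in> \<Delta>" for z
    unfolding e_def d_def using strip[OF that] s
    by (intro exp_strip_closer_to_1[OF \<alpha>]) (auto simp: k_def field_simps)
  have d_nz: "d z \<noteq> 0" if "z \<in> \<Delta>" for z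
    using less[OF that] by auto
  have hol_e: "e holomorphic_on \<Delta>" and hol_d: "d holomorphic_on \<Delta>"
    unfolding e_def d_def by (intro holomorphic_intros hol)+
  have hol_u: "u holomorphic_on \<Delta>"
    unfolding u_def by (intro holomorphic_intros hol_e hol_d d_nz)
  have u_le: "norm (u z) \<le> 1" if "z \<in> \<Delta>" for z
    using less[OF that] by (auto simp: u_def norm_divide divide_simps)
  define U where "U = fps_expansion u 0"
  have U: "u has_fps_expansion U"
    unfolding U_def by (rule has_fps_expansion_fps_expansion[OF _ _ hol_u]) auto
  define E where "E = fps_exp k oo Q"
  have Q0: "fps_nth Q 0 = 0"
    using q0 fps_nth_fps_expansion[OF Q, of 0] by simp
  have E: "e has_fps_expansion E"
    using has_fps_expansion_compose[OF has_fps_expansion_exp[of k] Q Q0]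
    by (simp add: e_def E_def o_def)
  have "(\<lambda>z. u z * d z) has_fps_expansion
      U * (fps_const (cis \<alpha>) - fps_const (cis (- \<alpha>)) * E)"
    unfolding d_def by (intro fps_expansion_intros U E)
  moreover have "(\<lambda>z. u z * d z) has_fps_expansion E - 1"
  proof -
    have "(\<lambda>z. e z - 1) has_fps_expansion E - 1"
      by (intro fps_expansion_intros E)
    moreover have "\<forall>\<^sub>F z in nhds 0. z \<in> \<Delta>"
      by (intro eventually_nhds_in_open) auto
    hence "\<forall>\<^sub>F z in nhds 0. u z * d z = e z - 1"
      by eventually_elim (use d_nz in \<open>auto simp: u_def\<close>)
    ultimately show ?thesis
      by (subst has_fps_expansion_cong) auto
  qed
  ultimately have eq: "U * (fps_const (cis \<alpha>) - fps_const (cis (- \<alpha>)) * E) = E - 1"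
    by (rule fps_expansion_unique_complex)
  have "norm (fps_nth U n) \<le> 1" for n
    using hol_u u_le U by (rule bounded_on_disc_imp_norm_fps_nth_le)
  with strip_to_disc_coeffs[OF _ Q0 E_def[unfolded k_def] eq] s
  show "norm (fps_nth Q 1) \<le> 1"
    "norm (fps_nth Q 2 + complex_of_real (cos \<alpha>) * (fps_nth Q 1)\<^sup>2) \<le> 1"
    by (metis less_irrefl)+
qed

section \<open>Coefficients of the starlike quotient\<close>

lemma normalized_expansion_has_fps_expansion:
  assumes "normalized_expansion f a"
  shows "f has_fps_expansion Abs_fps (\<lambda>n. if n = 0 then 0 else if n = 1 then 1 else a n)"
    (is "_ has_fps_expansion ?F")
proof -
  have sums: "(\<lambda>n. fps_nth ?F n * z ^ n) sums f z" if "z \<in> \<Delta>" for z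
  proof -
    have "(\<lambda>n. fps_nth ?F (n + 2) * z ^ (n + 2)) sums (f z - (\<Sum>n<2. fps_nth ?F n * z ^ n))"
      using assms that by (simp add: normalized_expansion_def numeral_2_eq_2)
    thus ?thesis by (subst (asm) sums_iff_shift) simp
  qed
  have "ereal (norm (1 / 2 :: complex)) \<le> fps_conv_radius ?F"
    unfolding fps_conv_radius_def
    by (rule conv_radius_geI, rule sums_summable, rule sums) simp
  moreover have "0 < ereal (norm (1 / 2 :: complex))" by simp
  ultimately have "0 < fps_conv_radius ?F" by (rule less_le_trans[rotated])
  moreover have "\<forall>\<^sub>F z in nhds 0. z \<in> \<Delta>"
    by (intro eventually_nhds_in_open) auto
  hence "\<forall>\<^sub>F z in nhds 0. eval_fps ?F z = f z"
    by eventually_elim (use sums[THEN sums_unique] in \<open>simp add: eval_fps_def\<close>)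
  ultimately show ?thesis
    by (auto simp: has_fps_expansion_def)
qed

text \<open>
  The singularity at \<open>0\<close> is removed by dividing \<open>z\<close> out of \<open>f\<close>: univalence makes \<open>f(z) / z\<close>
  zero-free off the origin, and its value at \<open>0\<close> is \<open>f'(0) = 1\<close>.
\<close>

lemma starlike_quotient_holomorphic:
  assumes f: "univalent f" and f0: "f 0 = 0" and df0: "deriv f 0 = 1"
  shows "starlike_quotient f holomorphic_on \<Delta>"
proof -
  have hol: "f holomorphic_on \<Delta>" and inj: "inj_on f \<Delta>"
    using f by (auto simp: univalent_def)
  define h where "h = (\<lambda>z. if z = 0 then deriv f 0 else (f z - f 0) / (z - 0))"
  have hol_h: "h holomorphic_on \<Delta>"
    unfolding h_def by (rule pole_lemma[OF hol]) auto
  have h_nz: "h z \<noteq> 0" if "z \<in> \<Delta>" for z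
    using inj_onD[OF inj, of z 0] that by (auto simp: h_def f0 df0)
  have "(\<lambda>z. deriv f z / h z) holomorphic_on \<Delta>"
    by (intro holomorphic_intros hol hol_h h_nz) auto
  thus ?thesis
    by (rule holomorphic_transform) (simp add: h_def f0 df0 starlike_quotient_def)
qed

text \<open>
  Both identities compare coefficients in \<open>F P = z F'\<close>, the form of \<open>p = z f' / f\<close> that makes
  sense for power series without constant term.
\<close>

lemma starlike_quotient_coeffs:
  assumes f: "univalent f" and P: "starlike_quotient f has_fps_expansion P"
    and F: "f has_fps_expansion F" and F01: "fps_nth F 0 = 0" "fps_nth F 1 = 1"
  shows "fps_nth P 1 = fps_nth F 2"
    and "2 * fps_nth F 3 = fps_nth P 2 + (fps_nth P 1)\<^sup>2"
proof -
  have f0: "f 0 = 0" using fps_nth_fps_expansion[OF F, of 0] F01 by simp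
  have inj: "inj_on f \<Delta>" using f by (simp add: univalent_def)
  have "(\<lambda>z. f z * starlike_quotient f z) has_fps_expansion F * P"
    by (intro fps_expansion_intros F P)
  moreover have "(\<lambda>z. f z * starlike_quotient f z) has_fps_expansion fps_X * fps_deriv F"
  proof -
    have "(\<lambda>z. z * deriv f z) has_fps_expansion fps_X * fps_deriv F"
      by (intro fps_expansion_intros F)
    moreover have "\<forall>\<^sub>F z in nhds 0. z \<in> \<Delta>"
      by (intro eventually_nhds_in_open) auto
    hence "\<forall>\<^sub>F z in nhds 0. f z * starlike_quotient f z = z * deriv f z"
    proof eventually_elim
      case (elim z)
      thus ?case using inj_onD[OF inj, of z 0] by (auto simp: starlike_quotient_def f0)
    qed
    ultimately show ?thesis by (subst has_fps_expansion_cong) auto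
  qed
  ultimately have "F * P = fps_X * fps_deriv F" by (rule fps_expansion_unique_complex)
  hence nth: "fps_nth (F * P) n = fps_nth (fps_X * fps_deriv F) n" for n by simp
  have P0: "fps_nth P 0 = 1"
    using fps_nth_fps_expansion[OF P, of 0] by (simp add: starlike_quotient_def)
  show P1: "fps_nth P 1 = fps_nth F 2"
    using nth[of 2] P0 F01 by (simp add: fps_mult_nth numeral_2_eq_2)
  show "2 * fps_nth F 3 = fps_nth P 2 + (fps_nth P 1)\<^sup>2"
    using nth[of 3] P0 P1 F01
    by (simp add: fps_mult_nth numeral_2_eq_2 numeral_3_eq_3 power2_eq_square algebra_simps)
qed

section \<open>The bound for the third coefficient\<close>

theorem corollary3p1:
  fixes \<alpha> :: real and f :: "complex \<Rightarrow> complex" and a :: "nat \<Rightarrow> complex"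
  assumes "pi / 2 \<le> \<alpha>" and "\<alpha> < pi"
    and "f \<in> class_M_Sigma \<alpha>"
    and "normalized_expansion f a"
  shows "norm (a 3) \<le> 1 / (1 + 1 / 2 * cos \<alpha>)"
proof -
  have \<alpha>: "0 < \<alpha>" "\<alpha> < pi" using assms(1,2) pi_gt_zero by linarith+
  have f: "univalent f" and strip: "strip_condition \<alpha> f"
    using assms(3) by (auto simp: class_M_Sigma_def class_Sigma_def)
  define F where "F = Abs_fps (\<lambda>n. if n = 0 then 0 else if n = 1 then 1 else a n)"
  have F: "f has_fps_expansion F"
    unfolding F_def by (rule normalized_expansion_has_fps_expansion[OF assms(4)])
  have Fn: "fps_nth F 0 = 0" "fps_nth F 1 = 1" "fps_nth F 3 = a 3"
    by (simp_all add: F_def)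
  have f0: "f 0 = 0" and df0: "deriv f 0 = 1"
    using fps_nth_fps_expansion[OF F, of 0] fps_nth_fps_expansion[OF F, of 1] Fn by simp_all
  define q where "q = (\<lambda>z. starlike_quotient f z - 1)"
  have hol_p: "starlike_quotient f holomorphic_on \<Delta>"
    using f f0 df0 by (rule starlike_quotient_holomorphic)
  define P where "P = fps_expansion (starlike_quotient f) 0"
  have P: "starlike_quotient f has_fps_expansion P"
    unfolding P_def by (rule has_fps_expansion_fps_expansion[OF _ _ hol_p]) auto
  have Q: "q has_fps_expansion P - 1"
    unfolding q_def by (intro fps_expansion_intros P)
  have hol_q: "q holomorphic_on \<Delta>"
    unfolding q_def by (intro holomorphic_intros hol_p)
  define c1 c2 where "c1 = fps_nth P 1"
    and "c2 = fps_nth P 2 + complex_of_real (cos \<alpha>) * (fps_nth P 1)\<^sup>2"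
  have c: "norm c1 \<le> 1" "norm c2 \<le> 1"
    using strip_function_coeff_bounds[OF \<alpha> hol_q _ _ _ Q] strip
    by (auto simp: q_def starlike_quotient_def strip_condition_def c1_def c2_def algebra_simps)
  define t where "t = - cos \<alpha>"
  have t: "0 \<le> t" "t \<le> 1"
    using cos_monotone_0_pi_le[of "pi / 2" \<alpha>] assms(1,2) by (auto simp: t_def)
  have "2 * a 3 = c2 + complex_of_real (1 + t) * c1\<^sup>2"
    using starlike_quotient_coeffs(2)[OF f P F Fn(1,2)]
    by (simp add: Fn(3) c1_def c2_def t_def algebra_simps)
  hence "2 * norm (a 3) = norm (c2 + complex_of_real (1 + t) * c1\<^sup>2)"
    by (metis norm_mult norm_numeral)
  also have "\<dots> \<le> norm c2 + (1 + t) * (norm c1)\<^sup>2"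
    using t norm_triangle_ineq[of c2 "complex_of_real (1 + t) * c1\<^sup>2"]
    by (simp only: norm_mult norm_power norm_of_real abs_of_nonneg add_nonneg_nonneg zero_le_one)
  also have "\<dots> \<le> 1 + (1 + t) * 1"
    using c t by (intro add_mono mult_left_mono) (auto simp: power_le_one)
  finally have "norm (a 3) \<le> 1 + t / 2" by simp
  also have "\<dots> \<le> 1 / (1 - t / 2)"
    using t by (simp add: field_simps)
  finally show ?thesis by (simp add: t_def)
qed

end
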